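(* For each $(x,y)\in\Lambda$ we have $v_\lambda^-(x)\le y\le v_\lambda^+(x)$. Moreover, the graphs $\{(x,v_\lambda^-(x)) : x\in X\}$ and $\{(x,v_\lambda^+(x)) : x\in X\}$ are subsets of $\Lambda$.
   Context: $X=\mathbb{R}/\mathbb{Z}$, $T:X\to X$ is the doubling map $T(x)=2x$, $0<\lambda<1$ is fixed, $\mathcal{C}=\{0,\dots,m-1\}$ with $m\ge 2$, and $A_c:X\to\mathbb{R}$ ($c\in\mathcal{C}$) are Lipschitz functions. $G_c(x,y)=(T(x),A_c(x)+\lambda y)$ on $X\times\mathbb{R}$. $\mathcal{I}=\{0,1\}$ and $\tau_i(x)=\frac12x+\frac i2$ (with $x\in[0,1)$ as representative), $i\in\mathcal{I}$, are the inverse branches of $T$. For $\bar c=(c_0,c_1,\dots)\in\mathcal{C}^{\mathbb{N}}$ and $\bar a=(a_0,a_1,\dots)\in\mathcal{I}^{\mathbb{N}}$ put $S_x(\bar c,\bar a)=\sum_{i\ge0}\lambda^iA_{c_i}(\tau_{a_i}\circ\cdots\circ\tau_{a_0}(x))$. $\Lambda$ is the set of $(x,y)\in X\times\mathbb{R}$ for which there exist $M>0$, $\bar c\in\mathcal{C}^{\mathbb{N}}$ and a sequence $(x_n,y_n)_{n\ge0}$ in $X\times\mathbb{R}$ with $(x_0,y_0)=(x,y)$, $G_{c_n}(x_{n+1},y_{n+1})=(x_n,y_n)$ and $|y_n|\le M$ for all $n\geq 0$; equivalently $\Lambda=\{(x,S_x(\bar c,\bar a)): x\in X,\ \bar c\in\mathcal{C}^{\mathbb{N}},\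 \bar a\in\mathcal{I}^{\mathbb{N}}\}$. $v_\lambda^+(x)=\max_{\bar c\in\mathcal{C}^{\mathbb{N}},\,\bar a\in\mathcal{I}^{\mathbb{N}}}S_x(\bar c,\bar a)$ and $v_\lambda^-(x)=\min_{\bar c\in\mathcal{C}^{\mathbb{N}},\,\bar a\in\mathcal{I}^{\mathbb{N}}}S_x(\bar c,\bar a)$. The function $v_\lambda^+$ is the unique continuous solution of the Bellman equation $v(x)=\max_{(c,a)\in\mathcal{C}\times\mathcal{I}}\left[A_c(\tau_a(x))+\lambda v(\tau_a(x))\right]$, and similarly $v_\lambda^-$ with $\min$. *)

theory Defs
  imports "HOL-Analysis.Analysis"
begin

section \<open>The circle $X = R/Z$ with its quotient metric\<close>

definition int_rel :: "real \<Rightarrow> real \<Rightarrow> bool" where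
  "int_rel x y \<longleftrightarrow> x - y \<in> \<int>"

lemma equivp_int_rel: "equivp int_rel"
proof (rule equivpI)
  show "reflp int_rel"
    by (auto simp: reflp_def int_rel_def)
  show "symp int_rel"
    by (auto simp: symp_def int_rel_def) (metis Ints_minus minus_diff_eq)
  show "transp int_rel"
  proof (rule transpI)
    fix x y z assume "int_rel x y" "int_rel y z"
    then have "(x - y) + (y - z) \<in> \<int>"
      unfolding int_rel_def by (rule Ints_add)
    then show "int_rel x z"
      by (simp add: int_rel_def)
  qed
qed

quotient_type circle = real / int_rel
  by (rule equivp_int_rel)

definition int_dist :: "real \<Rightarrow> real" where
  "int_dist s = (INF k::int. \<bar>s + of_int k\<bar>)"

lemma int_dist_round: "int_dist s = \<bar>s - of_int (round s)\<bar>"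
  unfolding int_dist_def
proof (rule cInf_eq_minimum)
  show "\<bar>s - of_int (round s)\<bar> \<in> range (\<lambda>k::int. \<bar>s + of_int k\<bar>)"
    by (rule range_eqI[where x = "- round s"]) simp
next
  fix t assume "t \<in> range (\<lambda>k::int. \<bar>s + of_int k\<bar>)"
  then obtain k :: int where "t = \<bar>s + of_int k\<bar>" by auto
  then show "\<bar>s - of_int (round s)\<bar> \<le> t"
    using round_diff_minimal[of s "- k"] by simp
qed

lemma int_dist_le: "int_dist s \<le> \<bar>s + of_int k\<bar>"
  using round_diff_minimal[of s "- k"] by (simp add: int_dist_round)

lemma int_dist_add_int: "int_dist (s + of_int k) = int_dist s"
  by (simp add: int_dist_round round_def add.commute[of _ "of_int k"] add.assoc)

lemma int_dist_minus: "int_dist (- s) = int_dist s"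
proof -
  have "int_dist (- u) \<le> int_dist u" for u
    using int_dist_le[of "- u" "round u"] by (simp add: int_dist_round abs_minus_commute)
  from this[of s] this[of "- s"] show ?thesis by simp
qed

lemma int_dist_triangle: "int_dist (s + t) \<le> int_dist s + int_dist t"
proof -
  have "int_dist (s + t) \<le> \<bar>s + t + of_int (- round s - round t)\<bar>"
    by (rule int_dist_le)
  also have "\<dots> \<le> \<bar>s - of_int (round s)\<bar> + \<bar>t - of_int (round t)\<bar>"
    by simp
  finally show ?thesis by (simp add: int_dist_round)
qed

lemma int_dist_eq_0_iff: "int_dist s = 0 \<longleftrightarrow> s \<in> \<int>"
proof
  assume "int_dist s = 0"
  then have "s = of_int (round s)" by (simp add: int_dist_round)
  then show "s \<in> \<int>" by (metis Ints_of_int)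
next
  assume "s \<in> \<int>"
  then show "int_dist s = 0" by (auto simp: int_dist_round elim: Ints_cases)
qed

instantiation circle :: metric_space
begin

lift_definition dist_circle :: "circle \<Rightarrow> circle \<Rightarrow> real" is "\<lambda>x y. int_dist (x - y)"
proof -
  fix x x' y y' assume "int_rel x x'" "int_rel y y'"
  then obtain j k where "x - x' = of_int j" "y - y' = of_int k"
    unfolding int_rel_def by (meson Ints_cases)
  then have "x - y = (x' - y') + of_int (j - k)" by simp
  then show "int_dist (x - y) = int_dist (x' - y')"
    by (metis int_dist_add_int)
qed

definition uniformity_circle :: "(circle \<times> circle) filter" where
  "uniformity_circle = (INF e\<in>{0<..}. principal {(x, y). dist x y < e})"

definition open_circle :: "circle set \<Rightarrow> bool" where
  "open_circle U \<longleftrightarrow> (\<forall>x\<in>U. eventually (\<lambda>(x', y). x' = x \<longrightarrow> y \<in> U) uniformity)"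

instance
proof
  show "(uniformity :: (circle \<times> circle) filter) =
      (INF e\<in>{0<..}. principal {(x, y). dist x y < e})"
    by (rule uniformity_circle_def)
  show "open U \<longleftrightarrow> (\<forall>x\<in>U. \<forall>\<^sub>F (x', y) in uniformity. x' = x \<longrightarrow> y \<in> U)" for U :: "circle set"
    by (rule open_circle_def)
  show "dist x y = 0 \<longleftrightarrow> x = y" for x y :: circle
    by transfer (simp add: int_dist_eq_0_iff int_rel_def)
  show "dist x y \<le> dist x z + dist y z" for x y z :: circle
  proof transfer
    fix x y z :: real
    show "int_dist (x - y) \<le> int_dist (x - z) + int_dist (y - z)"
      using int_dist_triangle[of "x - z" "z - y"] int_dist_minus[of "y - z"] by simp
  qed
qed

end

section \<open>The skew product and its inverse branches\<close>

lift_definition doubling :: "circle \<Rightarrow> circle" is "\<lambda>x. 2 * x"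
proof -
  fix x y assume "int_rel x y"
  then have "2 * (x - y) \<in> \<int>"
    unfolding int_rel_def by (intro Ints_mult) auto
  then show "int_rel (2 * x) (2 * y)"
    by (simp add: int_rel_def right_diff_distrib)
qed

text \<open>The representative in $[0,1)$.\<close>

lift_definition circle_rep :: "circle \<Rightarrow> real" is frac
proof -
  fix x y assume "int_rel x y"
  then obtain k where "x - y = of_int k"
    unfolding int_rel_def by (meson Ints_cases)
  then have "x = y + of_int k" by simp
  then show "frac x = frac y" by (simp add: frac_def)
qed

definition inv_branch :: "nat \<Rightarrow> circle \<Rightarrow> circle" where
  "inv_branch i x = abs_circle (circle_rep x / 2 + real i / 2)"

definition skew :: "real \<Rightarrow> (nat \<Rightarrow> circle \<Rightarrow> real) \<Rightarrow> nat \<Rightarrow> circle \<times> real \<Rightarrow> circle \<times> real" where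
  "skew lam A c = (\<lambda>(x, y). (doubling x, A c x + lam * y))"

text \<open>\<open>preorbit a n x\<close> applies the \<open>n + 1\<close> branches \<open>a 0\<close>, ..., \<open>a n\<close>, in this order.\<close>

primrec preorbit :: "(nat \<Rightarrow> nat) \<Rightarrow> nat \<Rightarrow> circle \<Rightarrow> circle" where
  "preorbit a 0 x = inv_branch (a 0) x"
| "preorbit a (Suc n) x = inv_branch (a (Suc n)) (preorbit a n x)"

definition S_sum ::
    "real \<Rightarrow> (nat \<Rightarrow> circle \<Rightarrow> real) \<Rightarrow> circle \<Rightarrow> (nat \<Rightarrow> nat) \<Rightarrow> (nat \<Rightarrow> nat) \<Rightarrow> real" where
  "S_sum lam A x c a = (\<Sum>i. lam ^ i * A (c i) (preorbit a i x))"

text \<open>Below, only the maps \<open>A c\<close> with \<open>c < m\<close> matter.\<close>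

definition Lambda_set :: "nat \<Rightarrow> real \<Rightarrow> (nat \<Rightarrow> circle \<Rightarrow> real) \<Rightarrow> (circle \<times> real) set" where
  "Lambda_set m lam A =
    {(x, y). \<exists>M>0. \<exists>c \<in> UNIV \<rightarrow> {..<m}. \<exists>xs ys.
       (xs 0, ys 0) = (x, y) \<and>
       (\<forall>n. skew lam A (c n) (xs (Suc n), ys (Suc n)) = (xs n, ys n)) \<and>
       (\<forall>n. \<bar>ys n\<bar> \<le> M)}"

definition S_values :: "nat \<Rightarrow> real \<Rightarrow> (nat \<Rightarrow> circle \<Rightarrow> real) \<Rightarrow> circle \<Rightarrow> real set" where
  "S_values m lam A x = {S_sum lam A x c a | c a. c \<in> UNIV \<rightarrow> {..<m} \<and> a \<in> UNIV \<rightarrow> {0, 1}}"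

text \<open>Genuine (attained) maximum and minimum: \<open>Max\<close> and \<open>Min\<close> are meaningful for finite
  sets only, and \<open>Sup\<close> and \<open>Inf\<close> need not be attained.\<close>

definition v_plus :: "nat \<Rightarrow> real \<Rightarrow> (nat \<Rightarrow> circle \<Rightarrow> real) \<Rightarrow> circle \<Rightarrow> real" where
  "v_plus m lam A x = (GREATEST s. s \<in> S_values m lam A x)"

definition v_minus :: "nat \<Rightarrow> real \<Rightarrow> (nat \<Rightarrow> circle \<Rightarrow> real) \<Rightarrow> circle \<Rightarrow> real" where
  "v_minus m lam A x = (LEAST s. s \<in> S_values m lam A x)"

end

theory Submission
  imports Defs
begin

text \<open>
  The two halves of the statement meet in the identity
  \<open>(x, y) \<in> \<Lambda> \<longleftrightarrow> y \<in> {S\<^sub>x(c, a)}\<close>. Along a bounded backward orbit the heights satisfy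
  \<open>y\<^sub>n = A (c\<^sub>n) (x\<^sub>n\<^sub>+\<^sub>1) + \<lambda> y\<^sub>n\<^sub>+\<^sub>1\<close>; unrolling this relation leaves a remainder \<open>\<lambda>\<^sup>n y\<^sub>n\<close> that tends
  to \<open>0\<close>, so \<open>y\<^sub>0\<close> is the discounted series (\<open>discounted_recursion_eq\<close>), and the points \<open>x\<^sub>n\<close> are a
  preorbit because the two inverse branches exhaust the fibres of the doubling map. Conversely the
  series \<open>S\<close> taken along the shifted sequences is a bounded backward orbit.

  It remains to see that the set of values \<open>S\<^sub>x(c, a)\<close> has a greatest and a least element
  (\<open>Sup_in_S_values\<close>). This is dynamic programming: the supremum \<open>V\<close> of the values satisfies
  \<open>V x \<le> max (A c (\<tau>\<^sub>a x) + \<lambda> V (\<tau>\<^sub>a x))\<close>, where the maximum runs over finitely many pairs \<open>(c, a)\<close>.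
  Choosing at each point a maximising pair and following these choices gives sequences for which
  the same unrolling yields \<open>V x \<le> S\<^sub>x(c, a)\<close>. The minimum is the maximum for the maps \<open>- A\<close>.
\<close>

section \<open>Discounted recursions\<close>

lemma summable_discounted:
  fixes lam :: real
  assumes "0 \<le> lam" "lam < 1" "\<And>n. \<bar>b n\<bar> \<le> K"
  shows "summable (\<lambda>n. lam ^ n * b n)"
proof (rule summable_comparison_test)
  show "\<exists>N. \<forall>n\<ge>N. norm (lam ^ n * b n) \<le> lam ^ n * K"
    using assms by (auto simp: abs_mult intro!: mult_left_mono)
  show "summable (\<lambda>n. lam ^ n * K)"
    using assms by (intro summable_mult2 summable_geometric) auto
qed

lemma abs_discounted_sum_le:
  fixes lam :: real
  assumes "0 \<le> lam" "lam < 1" "\<And>n. \<bar>b n\<bar> \<le> K"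
  shows "\<bar>\<Sum>n. lam ^ n * b n\<bar> \<le> K / (1 - lam)"
proof -
  have geom: "(\<lambda>n. K * lam ^ n) sums (K * (1 / (1 - lam)))"
    using assms by (intro sums_mult geometric_sums) auto
  have "norm (\<Sum>n. lam ^ n * b n) \<le> (\<Sum>n. K * lam ^ n)"
    using assms sums_summable[OF geom]
    by (intro norm_suminf_le) (auto simp: abs_mult mult.commute[of K] intro!: mult_left_mono)
  also have "\<dots> = K * (1 / (1 - lam))"
    using geom by (rule sums_unique[symmetric])
  finally show ?thesis by simp
qed

text \<open>
  Unrolling the hypothesis \<open>n\<close> times gives \<open>w 0 \<le> (\<Sum>i<n. lam ^ i * b i) + lam ^ n * w n\<close>, and the
  remainder vanishes in the limit because \<open>w\<close> is bounded.
\<close>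

lemma discounted_recursion_le:
  fixes lam :: real
  assumes lam: "0 \<le> lam" "lam < 1"
    and b: "\<And>n. \<bar>b n\<bar> \<le> K" and w: "\<And>n. \<bar>w n\<bar> \<le> M"
    and rec: "\<And>n. w n \<le> b n + lam * w (Suc n)"
  shows "w 0 \<le> (\<Sum>n. lam ^ n * b n)"
proof -
  have unrolled: "w 0 \<le> (\<Sum>i<n. lam ^ i * b i) + lam ^ n * w n" for n
  proof (induction n)
    case (Suc n)
    have "lam ^ n * w n \<le> lam ^ n * (b n + lam * w (Suc n))"
      using lam rec by (intro mult_left_mono) auto
    with Suc show ?case by (simp add: algebra_simps)
  qed simp
  have "(\<lambda>n. lam ^ n * M) \<longlonglongrightarrow> 0"
    using lam by (intro tendsto_mult_left_zero LIMSEQ_power_zero) auto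
  then have "(\<lambda>n. lam ^ n * w n) \<longlonglongrightarrow> 0"
    using lam w
    by (rule_tac Lim_null_comparison) (auto simp: abs_mult intro!: always_eventually mult_left_mono)
  then have "(\<lambda>n. (\<Sum>i<n. lam ^ i * b i) + lam ^ n * w n) \<longlonglongrightarrow> (\<Sum>n. lam ^ n * b n) + 0"
    by (intro tendsto_add summable_LIMSEQ summable_discounted[OF lam b])
  then show ?thesis
    using unrolled by (auto intro: LIMSEQ_le_const)
qed

lemma discounted_recursion_eq:
  fixes lam :: real
  assumes lam: "0 \<le> lam" "lam < 1"
    and b: "\<And>n. \<bar>b n\<bar> \<le> K" and w: "\<And>n. \<bar>w n\<bar> \<le> M"
    and rec: "\<And>n. w n = b n + lam * w (Suc n)"
  shows "w 0 = (\<Sum>n. lam ^ n * b n)"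
proof (rule antisym)
  show "w 0 \<le> (\<Sum>n. lam ^ n * b n)"
    using b w by (rule discounted_recursion_le[OF lam]) (rule eq_refl[OF rec])
  have "- w n \<le> - b n + lam * - w (Suc n)" for n
    using rec[of n] by linarith
  then have "- w 0 \<le> (\<Sum>n. lam ^ n * (- b n))"
    using b w by (intro discounted_recursion_le[OF lam, where w = "\<lambda>n. - w n" and K = K and M = M]) simp_all
  then show "(\<Sum>n. lam ^ n * b n) \<le> w 0"
    by (simp add: suminf_minus[OF summable_discounted[OF lam b]])
qed

section \<open>The circle and its inverse branches\<close>

lemma dist_circle_le: "dist x y \<le> 1 / 2" for x y :: circle
proof transfer
  fix x y :: real
  show "int_dist (x - y) \<le> 1 / 2"
    using of_int_round_abs_le[of "x - y"] by (simp add: int_dist_round abs_minus_commute)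
qed

text \<open>A Lipschitz function on a space of finite diameter is bounded.\<close>

lemma lipschitz_on_circle_bounded:
  fixes f :: "circle \<Rightarrow> real"
  assumes "L-lipschitz_on UNIV f"
  shows "\<exists>K. \<forall>x. \<bar>f x\<bar> \<le> K"
proof (intro exI allI)
  fix x
  define p where "p = abs_circle 0"
  have "\<bar>f x - f p\<bar> \<le> L * dist x p"
    using lipschitz_onD[OF assms, of x p] by (simp add: dist_real_def)
  also have "\<dots> \<le> L * (1 / 2)"
    using lipschitz_on_nonneg[OF assms] by (intro mult_left_mono dist_circle_le)
  finally show "\<bar>f x\<bar> \<le> \<bar>f (abs_circle 0)\<bar> + L * (1 / 2)"
    unfolding p_def by linarith
qed

lemma doubling_inv_branch: "doubling (inv_branch i x) = x"
  unfolding inv_branch_def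
proof (transfer fixing: i)
  fix x :: real
  have "2 * (frac x / 2 + real i / 2) - x = of_int (int i - \<lfloor>x\<rfloor>)"
    by (simp add: frac_def field_simps)
  then show "int_rel (2 * (frac x / 2 + real i / 2)) x"
    unfolding int_rel_def by (metis Ints_of_int)
qed

text \<open>
  If \<open>r\<close> represents \<open>z\<close>, then \<open>frac (2 * r) / 2\<close> equals \<open>r - \<lfloor>2 * r\<rfloor> / 2\<close>, which differs from \<open>r\<close> by an
  integer or by a half-integer according to the parity of \<open>\<lfloor>2 * r\<rfloor>\<close>; this parity is the branch.
\<close>

lemma inv_branch_doubling: "\<exists>i\<in>{0, 1}. z = inv_branch i (doubling z)"
  unfolding inv_branch_def
proof transfer
  fix r :: real
  define q where "q = \<lfloor>2 * r\<rfloor> div 2"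
  define i where "i = nat (\<lfloor>2 * r\<rfloor> mod 2)"
  have "i \<in> {0, 1}"
    unfolding i_def by auto
  moreover have "\<lfloor>2 * r\<rfloor> = 2 * q + int i"
    unfolding q_def i_def by simp
  then have "r - (frac (2 * r) / 2 + real i / 2) = of_int q"
    by (simp add: frac_def field_simps)
  ultimately show "\<exists>i\<in>{0, 1}. int_rel r (frac (2 * r) / 2 + real i / 2)"
    unfolding int_rel_def by (metis Ints_of_int)
qed

lemma preorbit_Suc_shift:
  "preorbit a (Suc n) x = preorbit (\<lambda>k. a (Suc k)) n (inv_branch (a 0) x)"
  by (induction n) simp_all

section \<open>Values of the series for bounded maps\<close>

text \<open>
  The hypotheses are invariant under \<open>A \<mapsto> - A\<close>, so every result on maxima in this context yields one on
  minima by a second interpretation.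
\<close>

locale bounded_maps =
  fixes m :: nat and lam :: real and A :: "nat \<Rightarrow> circle \<Rightarrow> real" and K :: real
  assumes m_pos: "0 < m" and lam_nonneg: "0 \<le> lam" and lam_less_1: "lam < 1"
    and A_bound: "c < m \<Longrightarrow> \<bar>A c x\<bar> \<le> K"
begin

lemma summable_S:
  assumes "c \<in> UNIV \<rightarrow> {..<m}"
  shows "summable (\<lambda>i. lam ^ i * A (c i) (preorbit a i x))"
  using assms lam_nonneg lam_less_1 A_bound by (intro summable_discounted[where K = K]) auto

lemma abs_S_sum_le:
  assumes "c \<in> UNIV \<rightarrow> {..<m}"
  shows "\<bar>S_sum lam A x c a\<bar> \<le> K / (1 - lam)"
  unfolding S_sum_def
  using assms lam_nonneg lam_less_1 A_bound by (intro abs_discounted_sum_le) auto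

lemma S_sum_unroll:
  assumes "c \<in> UNIV \<rightarrow> {..<m}"
  shows "S_sum lam A x c a = A (c 0) (inv_branch (a 0) x) +
    lam * S_sum lam A (inv_branch (a 0) x) (\<lambda>k. c (Suc k)) (\<lambda>k. a (Suc k))"
proof -
  let ?t = "\<lambda>i. lam ^ i * A (c (Suc i)) (preorbit (\<lambda>k. a (Suc k)) i (inv_branch (a 0) x))"
  have "summable ?t"
    using assms by (intro summable_S) auto
  moreover have "S_sum lam A x c a = A (c 0) (inv_branch (a 0) x) + (\<Sum>i. lam * ?t i)"
    using suminf_split_head[OF summable_S[OF assms, of a x]]
    by (simp add: S_sum_def preorbit_Suc_shift mult.assoc del: preorbit.simps(2))
  ultimately show ?thesis
    by (simp add: S_sum_def suminf_mult)
qed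

lemma S_values_nonempty: "S_values m lam A x \<noteq> {}"
proof -
  have "S_sum lam A x (\<lambda>_. 0) (\<lambda>_. 0) \<in> S_values m lam A x"
    using m_pos unfolding S_values_def by blast
  then show ?thesis by blast
qed

lemma abs_S_values_le: "s \<in> S_values m lam A x \<Longrightarrow> \<bar>s\<bar> \<le> K / (1 - lam)"
  unfolding S_values_def using abs_S_sum_le by blast

lemma bdd_above_S_values: "bdd_above (S_values m lam A x)"
  using abs_S_values_le by (intro bdd_aboveI[of _ "K / (1 - lam)"]) fastforce

lemma abs_Sup_S_values_le: "\<bar>Sup (S_values m lam A x)\<bar> \<le> K / (1 - lam)"
  using S_values_nonempty abs_S_values_le by (rule cSup_abs_le)

text \<open>
  Half of the Bellman equation, with the maximum replaced by a pair that attains it. The pairs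
  range over a finite set, so the best of them bounds the right-hand side
  of \<open>S_sum_unroll\<close> for all sequences at once.
\<close>

lemma Sup_S_values_le_step:
  "\<exists>c<m. \<exists>i\<in>{0, 1}. Sup (S_values m lam A x) \<le>
     A c (inv_branch i x) + lam * Sup (S_values m lam A (inv_branch i x))"
proof -
  define F where
    "F = (\<lambda>(c, i). A c (inv_branch i x) + lam * Sup (S_values m lam A (inv_branch i x)))"
  define P where "P = {..<m} \<times> {0, 1::nat}"
  have P: "finite P" "P \<noteq> {}"
    using m_pos by (auto simp: P_def)
  have "Sup (S_values m lam A x) \<le> Max (F ` P)"
  proof (rule cSup_least[OF S_values_nonempty])
    fix s assume "s \<in> S_values m lam A x"
    then obtain c a where s: "s = S_sum lam A x c a"
      and ca: "c \<in> UNIV \<rightarrow> {..<m}" "a \<in> UNIV \<rightarrow> {0, 1}"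
      unfolding S_values_def by blast
    let ?s' = "S_sum lam A (inv_branch (a 0) x) (\<lambda>k. c (Suc k)) (\<lambda>k. a (Suc k))"
    have "?s' \<in> S_values m lam A (inv_branch (a 0) x)"
      unfolding S_values_def using ca by blast
    then have "lam * ?s' \<le> lam * Sup (S_values m lam A (inv_branch (a 0) x))"
      by (intro mult_left_mono lam_nonneg cSup_upper bdd_above_S_values)
    then have "s \<le> F (c 0, a 0)"
      by (simp add: s F_def S_sum_unroll[OF ca(1)])
    also have "\<dots> \<le> Max (F ` P)"
      using P ca by (intro Max_ge) (auto simp: P_def)
    finally show "s \<le> Max (F ` P)" .
  qed
  moreover have "Max (F ` P) \<in> F ` P"
    using P by (intro Max_in) auto
  ultimately show ?thesis
    by (fastforce simp: F_def P_def)
qed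

text \<open>
  The supremum is attained along the greedy preorbit: choose at each point a pair from
  \<open>Sup_S_values_le_step\<close> and move to the corresponding preimage. The suprema along this preorbit
  are a bounded sequence to which \<open>discounted_recursion_le\<close> applies.
\<close>

lemma Sup_in_S_values:
  "Sup (S_values m lam A x) \<in> S_values m lam A x"
proof -
  let ?V = "\<lambda>z. Sup (S_values m lam A z)"
  obtain sc si where greedy: "\<And>z. sc z < m" "\<And>z. si z \<in> {0, 1}"
    "\<And>z. ?V z \<le> A (sc z) (inv_branch (si z) z) + lam * ?V (inv_branch (si z) z)"
    using Sup_S_values_le_step by metis
  define z where "z n = ((\<lambda>u. inv_branch (si u) u) ^^ n) x" for n
  define c where "c n = sc (z n)" for n
  define a where "a n = si (z n)" for n
  have z0: "z 0 = x" and zSuc: "z (Suc n) = inv_branch (a n) (z n)" for n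
    by (simp_all add: z_def a_def)
  have pre: "preorbit a n x = z (Suc n)" for n
    by (induction n) (simp_all add: z0 zSuc)
  have c: "c \<in> UNIV \<rightarrow> {..<m}" and a: "a \<in> UNIV \<rightarrow> {0, 1}"
    using greedy(1,2) by (auto simp: c_def a_def)
  have "?V (z 0) \<le> (\<Sum>n. lam ^ n * A (c n) (z (Suc n)))"
  proof (rule discounted_recursion_le[OF lam_nonneg lam_less_1, where w = "\<lambda>n. ?V (z n)"])
    show "\<bar>A (c n) (z (Suc n))\<bar> \<le> K" for n
      using c by (intro A_bound) auto
    show "\<bar>?V (z n)\<bar> \<le> K / (1 - lam)" for n
      by (rule abs_Sup_S_values_le)
    show "?V (z n) \<le> A (c n) (z (Suc n)) + lam * ?V (z (Suc n))" for n
      using greedy(3)[of "z n"] by (simp add: zSuc a_def c_def)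
  qed
  then have "?V x \<le> S_sum lam A x c a"
    by (simp add: S_sum_def pre z0)
  moreover have mem: "S_sum lam A x c a \<in> S_values m lam A x"
    unfolding S_values_def using c a by blast
  moreover have "S_sum lam A x c a \<le> ?V x"
    by (intro cSup_upper mem bdd_above_S_values)
  ultimately show ?thesis
    by (metis antisym)
qed

lemma v_plus_S_values:
  "v_plus m lam A x \<in> S_values m lam A x"
  "s \<in> S_values m lam A x \<Longrightarrow> s \<le> v_plus m lam A x"
proof -
  have "v_plus m lam A x = Sup (S_values m lam A x)"
    unfolding v_plus_def
    by (intro Greatest_equality Sup_in_S_values cSup_upper bdd_above_S_values)
  then show "v_plus m lam A x \<in> S_values m lam A x"
    "s \<in> S_values m lam A x \<Longrightarrow> s \<le> v_plus m lam A x"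
    by (simp_all add: Sup_in_S_values cSup_upper bdd_above_S_values)
qed

lemma S_values_uminus:
  "S_values m lam (\<lambda>c x. - A c x) x = uminus ` S_values m lam A x"
proof -
  have "S_sum lam (\<lambda>c x. - A c x) x c a = - S_sum lam A x c a" if "c \<in> UNIV \<rightarrow> {..<m}" for c a
    using suminf_minus[OF summable_S[OF that, of a x]] by (simp add: S_sum_def)
  then show ?thesis
    unfolding S_values_def image_def by (auto; metis)
qed

lemma v_minus_S_values:
  "v_minus m lam A x \<in> S_values m lam A x"
  "s \<in> S_values m lam A x \<Longrightarrow> v_minus m lam A x \<le> s"
proof -
  interpret neg: bounded_maps m lam "\<lambda>c x. - A c x" K
    by unfold_locales (use m_pos lam_nonneg lam_less_1 A_bound in auto)
  let ?s = "- v_plus m lam (\<lambda>c x. - A c x) x"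
  have mem: "?s \<in> S_values m lam A x"
    using neg.v_plus_S_values(1)[of x] unfolding S_values_uminus by auto
  have least: "?s \<le> t" if "t \<in> S_values m lam A x" for t
    using neg.v_plus_S_values(2)[of "- t" x] that unfolding S_values_uminus by auto
  have "v_minus m lam A x = ?s"
    unfolding v_minus_def using mem least by (rule Least_equality)
  then show "v_minus m lam A x \<in> S_values m lam A x"
    "s \<in> S_values m lam A x \<Longrightarrow> v_minus m lam A x \<le> s"
    using mem least by simp_all
qed

section \<open>Bounded backward orbits and values of the series\<close>

lemma Lambda_set_imp_S_values:
  assumes "(x, y) \<in> Lambda_set m lam A"
  shows "y \<in> S_values m lam A x"
proof -
  obtain M c xs ys where c: "c \<in> UNIV \<rightarrow> {..<m}" and start: "xs 0 = x" "ys 0 = y"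
    and orbit: "\<And>n. skew lam A (c n) (xs (Suc n), ys (Suc n)) = (xs n, ys n)"
    and M: "\<And>n. \<bar>ys n\<bar> \<le> M"
    using assms unfolding Lambda_set_def by auto
  have "doubling (xs (Suc n)) = xs n" for n
    using orbit[of n] by (simp add: skew_def)
  then have "\<exists>i\<in>{0, 1}. xs (Suc n) = inv_branch i (xs n)" for n
    using inv_branch_doubling[of "xs (Suc n)"] by simp
  then obtain a where a: "\<And>n. a n \<in> {0, 1}" "\<And>n. xs (Suc n) = inv_branch (a n) (xs n)"
    by metis
  have pre: "preorbit a n x = xs (Suc n)" for n
    by (induction n) (simp_all add: a(2) start)
  have "ys 0 = (\<Sum>n. lam ^ n * A (c n) (xs (Suc n)))"
  proof (rule discounted_recursion_eq[OF lam_nonneg lam_less_1 _ M])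
    show "\<bar>A (c n) (xs (Suc n))\<bar> \<le> K" for n
      using c by (intro A_bound) auto
    show "ys n = A (c n) (xs (Suc n)) + lam * ys (Suc n)" for n
      using orbit[of n] by (simp add: skew_def)
  qed
  then have "y = S_sum lam A x c a"
    by (simp add: S_sum_def pre start)
  then show ?thesis
    unfolding S_values_def using c a(1) by blast
qed

text \<open>
  The orbit witnessing membership consists of the preorbit of \<open>x\<close> and, at its \<open>n\<close>-th point, the series
  along the sequences shifted by \<open>n\<close>; \<open>S_sum_unroll\<close> is then exactly the equation of the skew product.
\<close>

lemma S_values_imp_Lambda_set:
  assumes "y \<in> S_values m lam A x"
  shows "(x, y) \<in> Lambda_set m lam A"
proof -
  obtain c a where y: "y = S_sum lam A x c a" and c: "c \<in> UNIV \<rightarrow> {..<m}"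
    using assms unfolding S_values_def by auto
  define xs where "xs = rec_nat x (\<lambda>n. inv_branch (a n))"
  define ys where "ys n = S_sum lam A (xs n) (\<lambda>k. c (k + n)) (\<lambda>k. a (k + n))" for n
  have xs: "xs 0 = x" "xs (Suc n) = inv_branch (a n) (xs n)" for n
    by (simp_all add: xs_def)
  have c_shift: "(\<lambda>k. c (k + n)) \<in> UNIV \<rightarrow> {..<m}" for n
    using c by auto
  have "skew lam A (c n) (xs (Suc n), ys (Suc n)) = (xs n, ys n)" for n
    using S_sum_unroll[OF c_shift[of n], of "xs n" "\<lambda>k. a (k + n)"]
    by (simp add: skew_def ys_def xs doubling_inv_branch)
  moreover have "\<bar>ys n\<bar> \<le> \<bar>K / (1 - lam)\<bar> + 1" for n
    using abs_S_sum_le[OF c_shift[of n], of "xs n" "\<lambda>k. a (k + n)"] unfolding ys_def by linarith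
  moreover have "(xs 0, ys 0) = (x, y)"
    by (simp add: xs ys_def y)
  moreover have "\<bar>K / (1 - lam)\<bar> + 1 > 0"
    by linarith
  ultimately have "\<exists>M>0. \<exists>c\<in>UNIV \<rightarrow> {..<m}. \<exists>xs ys. (xs 0, ys 0) = (x, y) \<and>
      (\<forall>n. skew lam A (c n) (xs (Suc n), ys (Suc n)) = (xs n, ys n)) \<and> (\<forall>n. \<bar>ys n\<bar> \<le> M)"
    using c by (intro exI[of _ "\<bar>K / (1 - lam)\<bar> + 1"] conjI bexI[of _ c] exI[of _ xs] exI[of _ ys]) auto
  then show ?thesis
    by (simp add: Lambda_set_def)
qed

end

theorem proposition2p8:
  fixes m :: nat and lam :: real and A :: "nat \<Rightarrow> circle \<Rightarrow> real"
  assumes "m \<ge> 2"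
    and "0 < lam" and "lam < 1"
    and "\<And>c. c < m \<Longrightarrow> \<exists>L. L-lipschitz_on UNIV (A c)"
  shows "(\<forall>(x, y) \<in> Lambda_set m lam A. v_minus m lam A x \<le> y \<and> y \<le> v_plus m lam A x) \<and>
    {(x, v_minus m lam A x) | x. x \<in> UNIV} \<subseteq> Lambda_set m lam A \<and>
    {(x, v_plus m lam A x) | x. x \<in> UNIV} \<subseteq> Lambda_set m lam A"
proof -
  have "\<forall>c\<in>{..<m}. \<exists>K. \<forall>x. \<bar>A c x\<bar> \<le> K"
    using assms(4) by (blast intro: lipschitz_on_circle_bounded)
  then obtain B where B: "\<And>c x. c < m \<Longrightarrow> \<bar>A c x\<bar> \<le> B c"
    using bchoice[of "{..<m}" "\<lambda>c K. \<forall>x. \<bar>A c x\<bar> \<le> K"] by (metis lessThan_iff)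
  have bound: "\<bar>A c x\<bar> \<le> Max (B ` {..<m})" if "c < m" for c x
    using that by (intro order_trans[OF B Max_ge]) auto
  interpret bounded_maps m lam A "Max (B ` {..<m})"
    by unfold_locales (use assms bound in auto)
  show ?thesis
    using v_plus_S_values v_minus_S_values Lambda_set_imp_S_values S_values_imp_Lambda_set by blast
qed

end
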